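(* Let $n\ge2$, and let $D=\{d_1,\ldots,d_k\}\subseteq\{2,3,\ldots,n\}$ with $2\le d_1<\cdots<d_k\le n$. Let $G(S_n,D)$ be the distance graph of $(S_n,\rho)$ with distance set $D$, where $\rho$ is the RT metric on $S_n$. Define graphs recursively by $H_1=K_{d_1}((d_1-1)!)$ and $H_j=\left[\frac{(d_j-1)!}{d_{j-1}!}H_{j-1}\right]^{d_j}$ for $j=2,\ldots,k$. Then $$G(S_n,D)\cong \frac{n!}{d_k!}\,H_k,$$ i.e. $G(S_n,D)\cong\frac{n!}{d_k!}\left[\frac{(d_k-1)!}{d_{k-1}!}\left[\cdots\left[\frac{(d_2-1)!}{d_1!}K_{d_1}((d_1-1)!)\right]^{d_2}\cdots\right]^{d_{k-1}}\right]^{d_k}$.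
   Context: $S_n$ is the symmetric group on $\{1,\ldots,n\}$. For $\alpha\in S_n$, $\omega(\alpha)=\max\{i:\alpha(i)\ne i\}$ (and $0$ for the identity), and the RT distance is $\rho(\alpha,\beta)=\omega(\alpha^{-1}\beta)$, which equals $\max\{i:\alpha(i)\neq\beta(i)\}$ for $\alpha\ne\beta$. For a metric space $(X,d)$ and a set $D$ of positive reals, the distance graph $G(X,D)$ has vertex set $X$ and an edge $xy$ for distinct $x,y\in X$ whenever $d(x,y)\in D$. For a graph $G$ and positive integer $m$, $mG$ denotes the disjoint union of $m$ copies of $G$, and $[G]^m$ denotes the join of $m$ copies of $G$ (disjoint union of the copies together with all edges between vertices of different copies). $K_r(m)$ denotes the complete $r$-partite graph with every part of size $m$. *)

theory Defs
  imports
    Complex_Main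
    "HOL-Combinatorics.Permutations"
    "Graph_Theory.Graph_Theory"
begin

text \<open>
  A simple graph is represented by a symmetric, loop-free digraph whose arcs are pairs of
  vertices (locale \<open>pair_graph\<close>); graph isomorphism is \<^const>\<open>digraph_iso\<close>.
\<close>

subsection \<open>The RT metric and distance graphs\<close>

definition sym_grp :: "nat \<Rightarrow> (nat \<Rightarrow> nat) set" where
  "sym_grp n = {p. p permutes {1..n}}"

definition omega :: "(nat \<Rightarrow> nat) \<Rightarrow> nat" where
  "omega p = (if p = id then 0 else Max {i. p i \<noteq> i})"

definition rt_dist :: "(nat \<Rightarrow> nat) \<Rightarrow> (nat \<Rightarrow> nat) \<Rightarrow> real" where
  "rt_dist p q = real (omega (inv p \<circ> q))"

lemma rt_dist_altdef:
  assumes "p \<in> sym_grp n" "q \<in> sym_grp n"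
  shows "rt_dist p q = (if p = q then 0 else real (Max {i. p i \<noteq> q i}))"
proof -
  have p: "bij p" using assms by (auto simp: sym_grp_def permutes_bij)
  have *: "inv p (q i) = i \<longleftrightarrow> p i = q i" for i
    using p by (metis bij_inv_eq_iff)
  then have "inv p \<circ> q = id \<longleftrightarrow> p = q" by (auto simp: fun_eq_iff)
  moreover have "{i. (inv p \<circ> q) i \<noteq> i} = {i. p i \<noteq> q i}" using * by auto
  ultimately show ?thesis by (simp add: rt_dist_def omega_def)
qed

lemma rt_dist_commute:
  assumes "p \<in> sym_grp n" "q \<in> sym_grp n"
  shows "rt_dist p q = rt_dist q p"
proof -
  have "{i. p i \<noteq> q i} = {i. q i \<noteq> p i}" by auto
  then show ?thesis using assms by (auto simp: rt_dist_altdef)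
qed

definition distance_graph ::
    "'a set \<Rightarrow> ('a \<Rightarrow> 'a \<Rightarrow> real) \<Rightarrow> real set \<Rightarrow> 'a pair_pre_digraph" where
  "distance_graph X d D =
     \<lparr>pverts = X, parcs = {(x, y). x \<in> X \<and> y \<in> X \<and> x \<noteq> y \<and> d x y \<in> D}\<rparr>"

lemma pair_graph_distance_graph_rt:
  "pair_graph (distance_graph (sym_grp n) rt_dist D)"
proof -
  have fin: "finite (sym_grp n)" by (simp add: sym_grp_def finite_permutations)
  have "{(x, y). x \<in> sym_grp n \<and> y \<in> sym_grp n \<and> x \<noteq> y \<and> rt_dist x y \<in> D}
          \<subseteq> sym_grp n \<times> sym_grp n" by auto
  then have "finite {(x, y). x \<in> sym_grp n \<and> y \<in> sym_grp n \<and> x \<noteq> y \<and> rt_dist x y \<in> D}"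
    using fin by (meson finite_SigmaI finite_subset)
  then show ?thesis using fin
    by unfold_locales (auto simp: distance_graph_def symmetric_def sym_def rt_dist_commute)
qed

subsection \<open>Disjoint unions, joins and complete multipartite graphs\<close>

text \<open>
  Vertices are lists of naturals so that the recursion below stays within one type:
  \<open>i # v\<close> is the vertex \<open>v\<close> of the \<open>i\<close>-th copy, and \<open>[i, a]\<close> is the \<open>a\<close>-th vertex of the
  \<open>i\<close>-th part of a complete multipartite graph.
\<close>

definition copies :: "nat \<Rightarrow> nat list pair_pre_digraph \<Rightarrow> nat list pair_pre_digraph" where
  "copies m G =
     \<lparr>pverts = {i # v | i v. i < m \<and> v \<in> pverts G},
      parcs = {(i # v, i # w) | i v w. i < m \<and> (v, w) \<in> parcs G}\<rparr>"

definition join_copies :: "nat \<Rightarrow> nat list pair_pre_digraph \<Rightarrow> nat list pair_pre_digraph" where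
  "join_copies m G =
     \<lparr>pverts = pverts (copies m G),
      parcs = parcs (copies m G) \<union>
        {(i # v, j # w) | i j v w. i < m \<and> j < m \<and> i \<noteq> j \<and> v \<in> pverts G \<and> w \<in> pverts G}\<rparr>"

definition complete_multipartite :: "nat \<Rightarrow> nat \<Rightarrow> nat list pair_pre_digraph" where
  "complete_multipartite r m =
     \<lparr>pverts = {[i, a] | i a. i < r \<and> a < m},
      parcs = {([i, a], [j, b]) | i a j b. i < r \<and> a < m \<and> j < r \<and> b < m \<and> i \<noteq> j}\<rparr>"

text \<open>
  The graphs \<open>H\<^sub>j\<close> for \<open>j \<ge> 1\<close>; the value at \<open>0\<close> is a dummy. The quotient of factorials is
  exact, since \<open>d j < d (Suc j)\<close> in all uses.
\<close>

fun H_graph :: "(nat \<Rightarrow> nat) \<Rightarrow> nat \<Rightarrow> nat list pair_pre_digraph" where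
  "H_graph d 0 = \<lparr>pverts = {}, parcs = {}\<rparr>"
| "H_graph d (Suc 0) = complete_multipartite (d 1) (fact (d 1 - 1))"
| "H_graph d (Suc (Suc j)) =
     join_copies (d (Suc (Suc j)))
       (copies (fact (d (Suc (Suc j)) - 1) div fact (d (Suc j))) (H_graph d (Suc j)))"

lemma pair_graphI:
  assumes "finite (pverts G)" "parcs G \<subseteq> pverts G \<times> pverts G" "sym (parcs G)"
    and "\<And>x. (x, x) \<notin> parcs G"
  shows "pair_graph G"
proof -
  have "finite (parcs G)" using assms(1,2) by (meson finite_SigmaI finite_subset)
  then show ?thesis using assms
    by unfold_locales (auto simp: symmetric_def)
qed

lemma pair_graphD:
  assumes "pair_graph G"
  shows "finite (pverts G)" "parcs G \<subseteq> pverts G \<times> pverts G" "sym (parcs G)"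
    and "\<And>x. (x, x) \<notin> parcs G"
proof -
  interpret pair_graph G by fact
  show "finite (pverts G)" by simp
  show "parcs G \<subseteq> pverts G \<times> pverts G" using arc_fst_in_verts arc_snd_in_verts by fastforce
  show "sym (parcs G)" using pair_sym_arcs by (simp add: symmetric_def)
  show "(x, x) \<notin> parcs G" for x using pair_no_loops by fastforce
qed

lemma pair_graph_copies:
  assumes "pair_graph G"
  shows "pair_graph (copies m G)"
proof (rule pair_graphI)
  note G = pair_graphD[OF assms]
  have "pverts (copies m G) = (\<lambda>(i, v). i # v) ` ({..<m} \<times> pverts G)"
    by (auto simp: copies_def)
  then show "finite (pverts (copies m G))" using G(1) by simp
  show "parcs (copies m G) \<subseteq> pverts (copies m G) \<times> pverts (copies m G)"
    using G(2) by (auto simp: copies_def)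
  show "sym (parcs (copies m G))"
    using G(3) by (auto simp: copies_def sym_def)
  show "(x, x) \<notin> parcs (copies m G)" for x using G(4) by (auto simp: copies_def)
qed

lemma pair_graph_join_copies:
  assumes "pair_graph G"
  shows "pair_graph (join_copies m G)"
proof (rule pair_graphI)
  note G = pair_graphD[OF pair_graph_copies[OF assms, of m]]
  show "finite (pverts (join_copies m G))" using G(1) by (simp add: join_copies_def)
  show "parcs (join_copies m G) \<subseteq> pverts (join_copies m G) \<times> pverts (join_copies m G)"
    using G(2) by (auto simp: join_copies_def) (auto simp: copies_def)
  show "sym (parcs (join_copies m G))"
    using G(3) by (auto simp: join_copies_def sym_def)
  show "(x, x) \<notin> parcs (join_copies m G)" for x using G(4) by (auto simp: join_copies_def)
qed

lemma pair_graph_complete_multipartite: "pair_graph (complete_multipartite r m)"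
proof (rule pair_graphI)
  have "pverts (complete_multipartite r m) = (\<lambda>(i, a). [i, a]) ` ({..<r} \<times> {..<m})"
    by (auto simp: complete_multipartite_def)
  then show "finite (pverts (complete_multipartite r m))" by simp
qed (auto simp: complete_multipartite_def sym_def)

lemma pair_graph_H_graph: "pair_graph (H_graph d j)"
proof (induction d j rule: H_graph.induct)
  case (1 d)
  show ?case by (rule pair_graphI) (auto simp: sym_def)
qed (simp_all add: pair_graph_complete_multipartite pair_graph_join_copies pair_graph_copies)

end

theory Submission
  imports Defs
begin

text \<open>
  The distance \<open>\<rho>\<close> is left invariant, and \<open>\<rho>(p, q) \<le> m\<close> holds iff \<open>p\<close> and \<open>q\<close> lie in the same left
  coset of \<open>S\<^sub>m\<close>. Cut \<open>S\<^sub>m\<close> into the left cosets of \<open>S\<^sub>l\<close>, where \<open>l \<le> m\<close>: there are \<open>m!/l!\<close> of them,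
  and each induces a copy of the distance graph of \<open>S\<^sub>l\<close>. If all admitted distances are at most \<open>l\<close>,
  there are no edges between different cosets. If \<open>l = m - 1\<close> and \<open>m\<close> is admitted, then all edges
  between different cosets are present, since the distance there is exactly \<open>m\<close>. Alternating the two
  observations along \<open>d\<^sub>1 < \<dots> < d\<^sub>k\<close> gives the nested unions and joins.
\<close>

section \<open>Graph isomorphisms from sets with a binary relation\<close>

text \<open>The source is a bare relation, not a digraph, so that the same relation can be
  restricted to a coset without building a new graph.\<close>

definition rel_iso :: "'a set \<Rightarrow> ('a \<Rightarrow> 'a \<Rightarrow> bool) \<Rightarrow> 'b pair_pre_digraph \<Rightarrow> bool" where
  "rel_iso X R G \<longleftrightarrow>
     (\<exists>\<phi>. bij_betw \<phi> X (pverts G) \<and> (\<forall>x\<in>X. \<forall>y\<in>X. R x y \<longleftrightarrow> (\<phi> x, \<phi> y) \<in> parcs G))"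

lemma rel_iso_bij_betw:
  assumes "bij_betw h X Y" "rel_iso Y S G"
    and "\<And>x y. x \<in> X \<Longrightarrow> y \<in> X \<Longrightarrow> R x y \<longleftrightarrow> S (h x) (h y)"
  shows "rel_iso X R G"
proof -
  obtain \<phi> where \<phi>: "bij_betw \<phi> Y (pverts G)"
      "\<forall>x\<in>Y. \<forall>y\<in>Y. S x y \<longleftrightarrow> (\<phi> x, \<phi> y) \<in> parcs G"
    using assms(2) unfolding rel_iso_def by blast
  have "bij_betw (\<phi> \<circ> h) X (pverts G)" using assms(1) \<phi>(1) by (rule bij_betw_trans)
  moreover have "\<forall>x\<in>X. \<forall>y\<in>X. R x y \<longleftrightarrow> ((\<phi> \<circ> h) x, (\<phi> \<circ> h) y) \<in> parcs G"
    using assms(3) \<phi>(2) bij_betwE[OF assms(1)] by simp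
  ultimately show ?thesis unfolding rel_iso_def by blast
qed

lemma rel_iso_cong:
  assumes "rel_iso X S G" "\<And>x y. x \<in> X \<Longrightarrow> y \<in> X \<Longrightarrow> R x y \<longleftrightarrow> S x y"
  shows "rel_iso X R G"
  using rel_iso_bij_betw[of id X X S G R] assms by simp

text \<open>Arcs are pairs of vertices, so the vertex bijection \<open>\<phi>\<close> forces the arc
  map \<open>map_prod \<phi> \<phi>\<close>.\<close>

lemma digraph_iso_with_proj_if_rel_iso:
  assumes G: "pair_graph G" and H: "pair_graph H"
    and iso: "rel_iso (pverts G) (\<lambda>x y. (x, y) \<in> parcs G) H"
  shows "digraph_iso (with_proj G) (with_proj H)"
proof -
  obtain \<phi> where \<phi>: "bij_betw \<phi> (pverts G) (pverts H)"
      "\<And>x y. x \<in> pverts G \<Longrightarrow> y \<in> pverts G \<Longrightarrow> (x, y) \<in> parcs G \<longleftrightarrow> (\<phi> x, \<phi> y) \<in> parcs H"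
    using iso unfolding rel_iso_def by blast
  note GD = pair_graphD[OF G] and HD = pair_graphD[OF H]
  interpret pair_graph G by fact
  have inj: "inj_on \<phi> (pverts G)" and im: "\<phi> ` pverts G = pverts H"
    using \<phi>(1) by (auto simp: bij_betw_def)
  have arcs: "map_prod \<phi> \<phi> ` parcs G = parcs H"
  proof (intro equalityI subsetI)
    fix e assume "e \<in> map_prod \<phi> \<phi> ` parcs G"
    then show "e \<in> parcs H" using \<phi>(2) GD(2) by force
  next
    fix e assume e: "e \<in> parcs H"
    obtain a b where ab: "e = (a, b)" by fastforce
    then have "a \<in> \<phi> ` pverts G" "b \<in> \<phi> ` pverts G" using e HD(2) im by auto
    then obtain x y where "x \<in> pverts G" "y \<in> pverts G" "a = \<phi> x" "b = \<phi> y" by blast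
    then show "e \<in> map_prod \<phi> \<phi> ` parcs G" using \<phi>(2) e ab by force
  qed
  define h where "h = \<lparr>iso_verts = \<phi>, iso_arcs = map_prod \<phi> \<phi>, iso_head = snd, iso_tail = fst\<rparr>"
  have "inj_on (map_prod \<phi> \<phi>) (parcs G)"
    using map_prod_inj_on[OF inj inj] GD(2) by (rule inj_on_subset)
  then have "pre_digraph.digraph_isomorphism (with_proj G) h"
    unfolding digraph_isomorphism_def h_def using inj wf_digraph_axioms by auto
  moreover have "app_iso h (with_proj G) = with_proj H"
    using im arcs by (simp add: app_iso_def h_def with_proj_def)
  ultimately show ?thesis unfolding digraph_iso_def by metis
qed

section \<open>Decomposing a graph along the fibres of a map\<close>

text \<open>Common core of the disjoint union and the join, which have the same vertices:
  \<open>g\<close> numbers the fibres and \<open>\<psi>\<close> is an isomorphism on each of them.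
  Only the arcs between different fibres are left open.\<close>

lemma fibrewise_labelling:
  assumes "finite X" and "\<And>c. c \<in> f ` X \<Longrightarrow> rel_iso {x \<in> X. f x = c} R G"
    and m: "card (f ` X) = m"
  obtains g \<psi> where "bij_betw (\<lambda>x. g (f x) # \<psi> x) X {i # v | i v. i < m \<and> v \<in> pverts G}"
    and "\<forall>x\<in>X. g (f x) < m" and "\<forall>x\<in>X. \<psi> x \<in> pverts G"
    and "\<forall>x\<in>X. \<forall>y\<in>X. g (f x) = g (f y) \<longleftrightarrow> f x = f y"
    and "\<forall>x\<in>X. \<forall>y\<in>X. f x = f y \<longrightarrow> (R x y \<longleftrightarrow> (\<psi> x, \<psi> y) \<in> parcs G)"
proof -
  obtain g where g: "bij_betw g (f ` X) {..<m}"
    using ex_bij_betw_finite_nat[of "f ` X"] assms(1) m by (auto simp: atLeast0LessThan)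
  have "\<forall>c\<in>f ` X. \<exists>\<phi>. bij_betw \<phi> {x \<in> X. f x = c} (pverts G) \<and>
      (\<forall>x\<in>{x \<in> X. f x = c}. \<forall>y\<in>{x \<in> X. f x = c}. R x y \<longleftrightarrow> (\<phi> x, \<phi> y) \<in> parcs G)"
    using assms(2) unfolding rel_iso_def by blast
  \<comment> \<open>The fibres come with unrelated isomorphisms; one is chosen for each fibre, and
    \<open>\<psi>\<close> glues them together.\<close>
  from bchoice[OF this] obtain \<Phi> where bij: "\<And>c. c \<in> f ` X \<Longrightarrow> bij_betw (\<Phi> c) {x \<in> X. f x = c} (pverts G)"
    and rel: "\<And>c. c \<in> f ` X \<Longrightarrow> \<forall>x\<in>{x \<in> X. f x = c}. \<forall>y\<in>{x \<in> X. f x = c}.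
        R x y \<longleftrightarrow> (\<Phi> c x, \<Phi> c y) \<in> parcs G"
    by blast
  define \<psi> where "\<psi> x = \<Phi> (f x) x" for x
  have lt: "g (f x) < m" if "x \<in> X" for x using bij_betwE[OF g] that by auto
  have \<psi>: "\<psi> x \<in> pverts G" if "x \<in> X" for x
    using bij_betwE[OF bij[of "f x"]] that by (auto simp: \<psi>_def)
  have eq: "g (f x) = g (f y) \<longleftrightarrow> f x = f y" if "x \<in> X" "y \<in> X" for x y
    using bij_betw_imp_inj_on[OF g] that by (auto simp: inj_on_def)
  have "R x y \<longleftrightarrow> (\<psi> x, \<psi> y) \<in> parcs G" if "x \<in> X" "y \<in> X" "f x = f y" for x y
    using rel[of "f x"] that by (auto simp: \<psi>_def)
  moreover have "bij_betw (\<lambda>x. g (f x) # \<psi> x) X {i # v | i v. i < m \<and> v \<in> pverts G}"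
    unfolding bij_betw_def
  proof (intro conjI inj_onI equalityI subsetI)
    fix x y assume xy: "x \<in> X" "y \<in> X" "g (f x) # \<psi> x = g (f y) # \<psi> y"
    then have "f x = f y" using eq by simp
    then show "x = y"
      using bij_betw_imp_inj_on[OF bij[of "f x"]] xy by (auto simp: inj_on_def \<psi>_def)
  next
    fix w assume "w \<in> {i # v | i v. i < m \<and> v \<in> pverts G}"
    then obtain i v where w: "w = i # v" "i < m" "v \<in> pverts G" by blast
    then have "i \<in> g ` (f ` X)" using bij_betw_imp_surj_on[OF g] by simp
    then obtain c where c: "c \<in> f ` X" "g c = i" by auto
    then have "v \<in> \<Phi> c ` {x \<in> X. f x = c}"
      using bij_betw_imp_surj_on[OF bij[OF c(1)]] w(3) by simp
    then obtain x where "x \<in> X" "f x = c" "v = \<Phi> c x" by blast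
    then show "w \<in> (\<lambda>x. g (f x) # \<psi> x) ` X"
      using w c by (intro image_eqI[of _ _ x]) (auto simp: \<psi>_def)
  qed (use lt \<psi> in auto)
  ultimately show ?thesis using lt \<psi> eq that[of g \<psi>] by blast
qed

lemma rel_iso_copies:
  assumes "finite X" "\<And>c. c \<in> f ` X \<Longrightarrow> rel_iso {x \<in> X. f x = c} R G" "card (f ` X) = m"
    and sep: "\<And>x y. x \<in> X \<Longrightarrow> y \<in> X \<Longrightarrow> f x \<noteq> f y \<Longrightarrow> \<not> R x y"
  shows "rel_iso X R (copies m G)"
proof -
  obtain g \<psi> where *: "bij_betw (\<lambda>x. g (f x) # \<psi> x) X {i # v | i v. i < m \<and> v \<in> pverts G}"
    "\<forall>x\<in>X. g (f x) < m" "\<forall>x\<in>X. \<psi> x \<in> pverts G"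
    "\<forall>x\<in>X. \<forall>y\<in>X. g (f x) = g (f y) \<longleftrightarrow> f x = f y"
    "\<forall>x\<in>X. \<forall>y\<in>X. f x = f y \<longrightarrow> (R x y \<longleftrightarrow> (\<psi> x, \<psi> y) \<in> parcs G)"
    by (rule fibrewise_labelling[OF assms(1-3)]) (assumption, rule that)
  have "R x y \<longleftrightarrow> (g (f x) # \<psi> x, g (f y) # \<psi> y) \<in> parcs (copies m G)"
    if "x \<in> X" "y \<in> X" for x y
    using that *(2-5) sep by (cases "f x = f y") (auto simp: copies_def)
  then show ?thesis using *(1) unfolding rel_iso_def by (auto simp: copies_def)
qed

lemma rel_iso_join_copies:
  assumes "finite X" "\<And>c. c \<in> f ` X \<Longrightarrow> rel_iso {x \<in> X. f x = c} R G" "card (f ` X) = m"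
    and join: "\<And>x y. x \<in> X \<Longrightarrow> y \<in> X \<Longrightarrow> f x \<noteq> f y \<Longrightarrow> R x y"
  shows "rel_iso X R (join_copies m G)"
proof -
  obtain g \<psi> where *: "bij_betw (\<lambda>x. g (f x) # \<psi> x) X {i # v | i v. i < m \<and> v \<in> pverts G}"
    "\<forall>x\<in>X. g (f x) < m" "\<forall>x\<in>X. \<psi> x \<in> pverts G"
    "\<forall>x\<in>X. \<forall>y\<in>X. g (f x) = g (f y) \<longleftrightarrow> f x = f y"
    "\<forall>x\<in>X. \<forall>y\<in>X. f x = f y \<longrightarrow> (R x y \<longleftrightarrow> (\<psi> x, \<psi> y) \<in> parcs G)"
    by (rule fibrewise_labelling[OF assms(1-3)]) (assumption, rule that)
  have "R x y \<longleftrightarrow> (g (f x) # \<psi> x, g (f y) # \<psi> y) \<in> parcs (join_copies m G)"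
    if "x \<in> X" "y \<in> X" for x y
    using that *(2-5) join
    by (cases "f x = f y") (auto simp: join_copies_def copies_def)
  then show ?thesis using *(1) unfolding rel_iso_def by (auto simp: copies_def join_copies_def)
qed

text \<open>Lets the first graph of the recursion be reached by the same join step as the later
  ones. One-element lists are used because \<open>i # [a]\<close> is \<open>[i, a]\<close>.\<close>

lemma complete_multipartite_eq_join_copies:
  "complete_multipartite r m = join_copies r \<lparr>pverts = {[a] | a. a < m}, parcs = {}\<rparr>"
  by (auto simp: complete_multipartite_def join_copies_def copies_def)

lemma rel_iso_edgeless:
  assumes "finite X" "card X = m" "\<And>x y. x \<in> X \<Longrightarrow> y \<in> X \<Longrightarrow> \<not> R x y"
  shows "rel_iso X R \<lparr>pverts = {[a] | a. a < m}, parcs = {}\<rparr>"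
proof -
  obtain g where "bij_betw g X {..<m}"
    using ex_bij_betw_finite_nat[of X] assms by (auto simp: atLeast0LessThan)
  moreover have "bij_betw (\<lambda>a. [a]) {..<m} {[a] | a. a < m}"
    by (auto simp: bij_betw_def inj_on_def)
  ultimately have "bij_betw ((\<lambda>a. [a]) \<circ> g) X {[a] | a. a < m}" by (rule bij_betw_trans)
  then show ?thesis unfolding rel_iso_def using assms(3) by auto
qed

lemma card_image_eq_div:
  assumes "finite X" "\<And>y. y \<in> f ` X \<Longrightarrow> card {x \<in> X. f x = y} = c" "c > 0"
  shows "card (f ` X) = card X div c"
proof -
  have "card X = (\<Sum>y\<in>f ` X. card {x \<in> X. f x = y})"
    using sum.image_gen[OF assms(1), of "\<lambda>_. 1 :: nat" f] by simp
  also have "\<dots> = card (f ` X) * c" using assms(2) by simp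
  finally show ?thesis using assms(3) by simp
qed

section \<open>Left cosets and the RT metric\<close>

lemma omega_le_iff_permutes:
  assumes "p permutes {1..n}"
  shows "omega p \<le> m \<longleftrightarrow> p permutes {1..m}"
proof -
  have fin: "finite {i. p i \<noteq> i}"
    using assms by (auto intro!: finite_subset[of _ "{1..n}"] simp: permutes_def)
  \<comment> \<open>The point \<open>0\<close> satisfies \<open>i \<le> m\<close> but lies outside
    \<open>{1..m}\<close>, so the bound on moved points does not show that it is fixed.\<close>
  have p0: "p 0 = 0" using assms by (auto simp: permutes_def)
  have "omega p \<le> m \<longleftrightarrow> (\<forall>i. p i \<noteq> i \<longrightarrow> i \<le> m)"
  proof (cases "p = id")
    case False
    then have "{i. p i \<noteq> i} \<noteq> {}" by auto
    then show ?thesis using False fin by (auto simp: omega_def)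
  qed (simp add: omega_def)
  also have "\<dots> \<longleftrightarrow> p permutes {1..m}"
  proof
    assume *: "\<forall>i. p i \<noteq> i \<longrightarrow> i \<le> m"
    have "p i = i" if "i \<notin> {1..m}" for i
      using * p0 that by (cases "i = 0") auto
    then show "p permutes {1..m}" using assms unfolding permutes_def by blast
  next
    assume "p permutes {1..m}"
    then show "\<forall>i. p i \<noteq> i \<longrightarrow> i \<le> m" by (auto simp: permutes_def)
  qed
  finally show ?thesis .
qed

text \<open>The coset as a set serves as the value of the fibre map \<open>f\<close>, which avoids
  choosing representatives.\<close>

definition left_coset :: "nat \<Rightarrow> (nat \<Rightarrow> nat) \<Rightarrow> (nat \<Rightarrow> nat) set" where
  "left_coset l p = (\<lambda>r. p \<circ> r) ` sym_grp l"

lemma inv_comp_in_sym_grp: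
  "p \<in> sym_grp m \<Longrightarrow> q \<in> sym_grp m \<Longrightarrow> inv p \<circ> q \<in> sym_grp m"
  by (simp add: sym_grp_def permutes_compose permutes_inv)

lemma omega_inv_comp_le:
  assumes "p \<in> sym_grp m" "q \<in> sym_grp m"
  shows "omega (inv p \<circ> q) \<le> m"
  using inv_comp_in_sym_grp[OF assms] omega_le_iff_permutes by (simp add: sym_grp_def)

lemma mem_left_coset_iff:
  assumes "p \<in> sym_grp m"
  shows "q \<in> left_coset l p \<longleftrightarrow> inv p \<circ> q \<in> sym_grp l"
proof -
  have "p \<circ> inv p = id" "inv p \<circ> p = id"
    using assms by (auto simp: sym_grp_def permutes_inv_o)
  then have "q = p \<circ> r \<longleftrightarrow> r = inv p \<circ> q" for r
    by (metis comp_assoc id_comp)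
  then show ?thesis unfolding left_coset_def image_iff by simp
qed

lemma left_coset_eq_iff:
  assumes "p \<in> sym_grp m" "q \<in> sym_grp m"
  shows "left_coset l p = left_coset l q \<longleftrightarrow> inv p \<circ> q \<in> sym_grp l"
proof
  assume "left_coset l p = left_coset l q"
  moreover have "q \<in> left_coset l q"
    unfolding mem_left_coset_iff[OF assms(2)] using assms(2)
    by (simp add: sym_grp_def permutes_inv_o)
  ultimately show "inv p \<circ> q \<in> sym_grp l" using mem_left_coset_iff[OF assms(1)] by blast
next
  assume "inv p \<circ> q \<in> sym_grp l"
  then have "inv p \<circ> q permutes {1..l}" by (simp add: sym_grp_def)
  \<comment> \<open>Left multiplication by an element of a group maps the group onto itself.\<close>
  then have "(\<lambda>r. (inv p \<circ> q) \<circ> r) ` sym_grp l = sym_grp l"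
    using image_compose_permutations_left unfolding sym_grp_def by (simp add: image_Collect)
  then have "left_coset l p = (\<lambda>r. p \<circ> (inv p \<circ> q \<circ> r)) ` sym_grp l"
    unfolding left_coset_def by (metis image_image)
  also have "\<dots> = left_coset l q"
    using assms(1) by (simp add: left_coset_def sym_grp_def o_assoc permutes_inv_o)
  finally show "left_coset l p = left_coset l q" .
qed

text \<open>The bridge between group and metric: different cosets are exactly those at distance
  greater than \<open>l\<close>.\<close>

lemma left_coset_eq_iff_omega:
  assumes "p \<in> sym_grp m" "q \<in> sym_grp m"
  shows "left_coset l p = left_coset l q \<longleftrightarrow> omega (inv p \<circ> q) \<le> l"
  using left_coset_eq_iff[OF assms] inv_comp_in_sym_grp[OF assms] omega_le_iff_permutes
  by (simp add: sym_grp_def)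

lemma sym_grp_mono: "l \<le> m \<Longrightarrow> sym_grp l \<subseteq> sym_grp m"
  by (auto simp: sym_grp_def intro: permutes_subset)

text \<open>Translation by \<open>inv p\<close> moves the coset of \<open>p\<close> onto the
  subgroup. It serves both to count cosets and to transport the graph structure.\<close>

lemma left_coset_fibre:
  assumes "p \<in> sym_grp m" "l \<le> m"
  shows "bij_betw (\<lambda>q. inv p \<circ> q) {q \<in> sym_grp m. left_coset l q = left_coset l p} (sym_grp l)"
proof (rule bij_betw_byWitness[where f' = "\<lambda>r. p \<circ> r"])
  have p_inv: "p \<circ> inv p = id" "inv p \<circ> p = id"
    using assms by (auto simp: sym_grp_def permutes_inv_o)
  show "\<forall>q\<in>{q \<in> sym_grp m. left_coset l q = left_coset l p}. p \<circ> (inv p \<circ> q) = q"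
    by (simp add: o_assoc p_inv)
  show inv_p: "\<forall>r\<in>sym_grp l. inv p \<circ> (p \<circ> r) = r" by (simp add: o_assoc p_inv)
  show "(\<lambda>q. inv p \<circ> q) ` {q \<in> sym_grp m. left_coset l q = left_coset l p} \<subseteq> sym_grp l"
    using left_coset_eq_iff[OF assms(1)] by fastforce
  show "(\<lambda>r. p \<circ> r) ` sym_grp l \<subseteq> {q \<in> sym_grp m. left_coset l q = left_coset l p}"
  proof (intro image_subsetI CollectI conjI)
    fix r assume r: "r \<in> sym_grp l"
    then have "r \<in> sym_grp m" using sym_grp_mono[OF assms(2)] by auto
    then show pr: "p \<circ> r \<in> sym_grp m"
      using assms(1) by (simp add: sym_grp_def permutes_compose)
    show "left_coset l (p \<circ> r) = left_coset l p"
      using left_coset_eq_iff[OF assms(1) pr, of l] inv_p r by simp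
  qed
qed

lemma finite_sym_grp: "finite (sym_grp m)"
  by (simp add: sym_grp_def finite_permutations)

lemma card_sym_grp: "card (sym_grp m) = fact m"
  by (simp add: sym_grp_def card_permutations)

lemma card_left_cosets:
  assumes "l \<le> m"
  shows "card (left_coset l ` sym_grp m) = fact m div fact l"
proof -
  have "card {q \<in> sym_grp m. left_coset l q = c} = fact l" if "c \<in> left_coset l ` sym_grp m" for c
    using that bij_betw_same_card[OF left_coset_fibre[OF _ assms]] by (auto simp: card_sym_grp)
  then show ?thesis
    using card_image_eq_div[OF finite_sym_grp, of "left_coset l" m "fact l"]
    by (simp add: card_sym_grp)
qed

section \<open>Distance graphs of symmetric groups as unions and joins\<close>

text \<open>Adjacency with distances kept in the naturals. Distinctness of the two vertices will
  come from \<open>0 \<notin> D\<close>, since the identity has \<open>omega\<close> equal to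
  \<open>0\<close>.\<close>

definition omega_adj :: "nat set \<Rightarrow> (nat \<Rightarrow> nat) \<Rightarrow> (nat \<Rightarrow> nat) \<Rightarrow> bool" where
  "omega_adj D p q \<longleftrightarrow> omega (inv p \<circ> q) \<in> D"

text \<open>Left invariance: in \<open>inv (inv p \<circ> q) \<circ> (inv p \<circ> q')\<close> the
  factor \<open>p\<close> cancels, so the translation onto \<open>sym_grp l\<close> preserves
  adjacency.\<close>

lemma rel_iso_left_coset_fibre:
  assumes "rel_iso (sym_grp l) (omega_adj D) G" "l \<le> m" "c \<in> left_coset l ` sym_grp m"
  shows "rel_iso {q \<in> sym_grp m. left_coset l q = c} (omega_adj D) G"
proof -
  obtain p where p: "p \<in> sym_grp m" "c = left_coset l p" using assms(3) by blast
  have "inv (inv p \<circ> q) \<circ> (inv p \<circ> q') = inv q \<circ> q'" if "q \<in> sym_grp m" for q q' :: "nat \<Rightarrow> nat"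
  proof -
    have bij: "bij p" "bij q" using p(1) that by (auto simp: sym_grp_def permutes_bij)
    then have "inv (inv p \<circ> q) = inv q \<circ> p" by (simp add: o_inv_distrib bij_imp_bij_inv inv_inv_eq)
    then show ?thesis using bij(1)
      by (metis bij_is_surj comp_assoc comp_id surj_iff)
  qed
  then have "omega_adj D q q' \<longleftrightarrow> omega_adj D (inv p \<circ> q) (inv p \<circ> q')" if "q \<in> sym_grp m" for q q'
    using that by (simp add: omega_adj_def)
  then show ?thesis
    using rel_iso_bij_betw[OF left_coset_fibre[OF p(1) assms(2)] assms(1)] p(2) by simp
qed

text \<open>Elements of different cosets are more than \<open>l\<close> apart, beyond every distance
  in \<open>D\<close>.\<close>

lemma rel_iso_sym_grp_copies:
  assumes "rel_iso (sym_grp l) (omega_adj D) G" "l \<le> m" "\<And>x. x \<in> D \<Longrightarrow> x \<le> l"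
  shows "rel_iso (sym_grp m) (omega_adj D) (copies (fact m div fact l) G)"
proof (rule rel_iso_copies[OF finite_sym_grp rel_iso_left_coset_fibre[OF assms(1,2)]
      card_left_cosets[OF assms(2)]])
  show "\<not> omega_adj D p q"
    if "p \<in> sym_grp m" "q \<in> sym_grp m" "left_coset l p \<noteq> left_coset l q" for p q
    using that assms(3) by (auto simp: left_coset_eq_iff_omega omega_adj_def)
qed

text \<open>The subgroup has index \<open>m\<close>, and between different cosets the distance is
  squeezed between \<open>m - 1\<close> (exclusive) and \<open>m\<close>.\<close>

lemma rel_iso_sym_grp_join_copies:
  assumes "rel_iso (sym_grp (m - 1)) (omega_adj D) G" "m \<in> D" "m \<ge> 1"
  shows "rel_iso (sym_grp m) (omega_adj D) (join_copies m G)"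
proof (rule rel_iso_join_copies[OF finite_sym_grp rel_iso_left_coset_fibre[OF assms(1) diff_le_self]])
  show "card (left_coset (m - 1) ` sym_grp m) = m"
    using assms(3) card_left_cosets[of "m - 1" m] by (cases m) auto
  show "omega_adj D p q"
    if "p \<in> sym_grp m" "q \<in> sym_grp m" "left_coset (m - 1) p \<noteq> left_coset (m - 1) q" for p q
  proof -
    have "omega (inv p \<circ> q) \<le> m" using that(1,2) by (rule omega_inv_comp_le)
    moreover have "\<not> omega (inv p \<circ> q) \<le> m - 1"
      using left_coset_eq_iff_omega[OF that(1,2)] that(3) by simp
    ultimately have "omega (inv p \<circ> q) = m" by simp
    then show ?thesis using assms(2) by (simp add: omega_adj_def)
  qed
qed

text \<open>Distances in \<open>sym_grp m\<close> never exceed \<open>m\<close>, so only the part of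
  \<open>D\<close> up to \<open>m\<close> matters.\<close>

lemma rel_iso_omega_adj_cong:
  assumes "rel_iso (sym_grp m) (omega_adj D) G" "\<And>x. x \<le> m \<Longrightarrow> x \<in> D' \<longleftrightarrow> x \<in> D"
  shows "rel_iso (sym_grp m) (omega_adj D') G"
proof (rule rel_iso_cong[OF assms(1)])
  fix p q assume "p \<in> sym_grp m" "q \<in> sym_grp m"
  then have "omega (inv p \<circ> q) \<le> m" by (rule omega_inv_comp_le)
  then show "omega_adj D' p q \<longleftrightarrow> omega_adj D p q" using assms(2) by (simp add: omega_adj_def)
qed

section \<open>Induction along the distance set\<close>

lemma rel_iso_H_graph:
  assumes "strict_mono_on {1..k} d" "1 \<le> d 1" "j \<in> {1..k}"
  shows "rel_iso (sym_grp (d j)) (omega_adj (d ` {1..j})) (H_graph d j)"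
proof -
  have "1 \<le> j" "j \<le> k" using assms(3) by auto
  then show ?thesis
  proof (induction j rule: dec_induct)
    case base
    \<comment> \<open>One level below \<open>d 1\<close> the distance \<open>d 1\<close> does not
      occur, so the graph is edgeless: a single part of the multipartite graph.\<close>
    have "rel_iso (sym_grp (d 1 - 1)) (omega_adj {d 1})
        \<lparr>pverts = {[a] | a :: nat. a < fact (d 1 - 1)}, parcs = {}\<rparr>"
    proof (rule rel_iso_edgeless[OF finite_sym_grp card_sym_grp])
      fix p q assume "p \<in> sym_grp (d 1 - 1)" "q \<in> sym_grp (d 1 - 1)"
      then show "\<not> omega_adj {d 1} p q"
        using omega_inv_comp_le[of p "d 1 - 1" q] assms(2) by (auto simp: omega_adj_def)
    qed
    then show ?case
      using rel_iso_sym_grp_join_copies[of "d 1" "{d 1}"] assms(2)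
      by (simp add: complete_multipartite_eq_join_copies)
  next
    case (step j)
    have less: "d j < d (Suc j)"
      using assms(1) step.hyps step.prems by (auto simp: strict_mono_on_def)
    have le: "d i \<le> d j" if "i \<in> {1..j}" for i
      using strict_mono_on_leD[OF assms(1)] that step.prems by auto
    have "rel_iso (sym_grp (d j)) (omega_adj (d ` {1..j})) (H_graph d j)" using step by simp
    then have "rel_iso (sym_grp (d (Suc j) - 1)) (omega_adj (d ` {1..j}))
        (copies (fact (d (Suc j) - 1) div fact (d j)) (H_graph d j))"
      by (rule rel_iso_sym_grp_copies) (use less le in auto)
    then have "rel_iso (sym_grp (d (Suc j) - 1)) (omega_adj (d ` {1..Suc j}))
        (copies (fact (d (Suc j) - 1) div fact (d j)) (H_graph d j))"
      by (rule rel_iso_omega_adj_cong) (use less in \<open>auto simp: atLeastAtMostSuc_conv\<close>)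
    then have "rel_iso (sym_grp (d (Suc j))) (omega_adj (d ` {1..Suc j}))
        (join_copies (d (Suc j)) (copies (fact (d (Suc j) - 1) div fact (d j)) (H_graph d j)))"
      by (rule rel_iso_sym_grp_join_copies) (use less in auto)
    \<comment> \<open>The recursive equation of \<open>H_graph\<close> matches only on
      \<open>Suc (Suc i)\<close>.\<close>
    moreover obtain i where "j = Suc i" using step.hyps by (cases j) auto
    ultimately show ?case by simp
  qed
qed

theorem theorem4p2:
  fixes n k :: nat and d :: "nat \<Rightarrow> nat" and D :: "nat set"
  assumes "n \<ge> 2" and "k \<ge> 1"
    and "D = d ` {1..k}"
    and "strict_mono_on {1..k} d"
    and "2 \<le> d 1" and "d k \<le> n"
  shows "digraph_iso
           (with_proj (distance_graph (sym_grp n) rt_dist (real ` D)))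
           (with_proj (copies (fact n div fact (d k)) (H_graph d k)))"
proof (rule digraph_iso_with_proj_if_rel_iso)
  let ?G = "distance_graph (sym_grp n) rt_dist (real ` D)"
  have ge: "d 1 \<le> d i" "d i \<le> d k" if "i \<in> {1..k}" for i
    using strict_mono_on_leD[OF assms(4)] that by auto
  have "rel_iso (sym_grp (d k)) (omega_adj D) (H_graph d k)"
    using rel_iso_H_graph[OF assms(4)] assms(2,3,5) by simp
  then have "rel_iso (sym_grp n) (omega_adj D) (copies (fact n div fact (d k)) (H_graph d k))"
    by (rule rel_iso_sym_grp_copies) (use ge assms(3,6) in auto)
  moreover have "(p, q) \<in> parcs ?G \<longleftrightarrow> omega_adj D p q" if "p \<in> sym_grp n" "q \<in> sym_grp n" for p q
  proof -
    \<comment> \<open>This excludes loops from \<open>omega_adj D\<close>, matching the condition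
      \<open>x \<noteq> y\<close> in \<open>distance_graph\<close>.\<close>
    have "0 \<notin> D" using ge(1) assms(3,5) by fastforce
    moreover have "omega (inv p \<circ> p) = 0"
      using that(1) by (simp add: sym_grp_def permutes_inv_o omega_def)
    ultimately have "\<not> omega_adj D p p" by (simp add: omega_adj_def)
    then show ?thesis
      using that by (auto simp: distance_graph_def rt_dist_def omega_adj_def)
  qed
  ultimately show "rel_iso (pverts ?G) (\<lambda>p q. (p, q) \<in> parcs ?G)
      (copies (fact n div fact (d k)) (H_graph d k))"
    by (simp add: distance_graph_def rel_iso_cong)
qed (simp_all add: pair_graph_distance_graph_rt pair_graph_copies pair_graph_H_graph)

end
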